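(* Let $(Y,d)$ be a metric space, $X\subset Y$, and let $(X,\delta)$ be a complete metric space. If $F\colon X\to 2^{Y}$ is a mapping such that the function $x\mapsto d(x,F(x))$ is lower semicontinuous on $(X,\delta)$, and for each $x\in X\setminus F(x)$ there exists a $z\in X\setminus\{x\}$ with $$\delta(x,z)\le d(x,F(x))-d(z,F(z)),$$ then $F$ has a fixed point.
   Context: $2^{Y}$ is the family of all subsets of $Y$; a mapping $F\colon X\to 2^{Y}$ is understood to satisfy $X\neq\emptyset$ and $F(x)\neq\emptyset$ for all $x\in X$. "For each $x\in X\setminus F(x)$" means for each $x\in X$ with $x\notin F(x)$. For a nonempty $A\subset Y$, $d(x,A)=\inf_{a\in A}d(x,a)$. A fixed point of $F$ is an $x\in X$ with $x\in F(x)$. *)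

theory Defs
  imports "HOL-Analysis.Analysis"
begin

(* The infimum is taken in the conditionally complete lattice of the reals: it is the
   paper's d(x,A) only for nonempty A (on which d x is bounded below by 0). *)
definition point_set_dist :: "('a \<Rightarrow> 'a \<Rightarrow> real) \<Rightarrow> 'a \<Rightarrow> 'a set \<Rightarrow> real"
  where "point_set_dist d x A = (INF a\<in>A. d x a)"

definition lower_semicontinuous_map :: "'a topology \<Rightarrow> ('a \<Rightarrow> real) \<Rightarrow> bool"
  where "lower_semicontinuous_map T f \<longleftrightarrow> (\<forall>c. openin T {x \<in> topspace T. c < f x})"

lemma lower_semicontinuous_map_pointwise:
  "lower_semicontinuous_map T f \<longleftrightarrow>
    (\<forall>x \<in> topspace T. \<forall>c < f x. \<exists>U. openin T U \<and> x \<in> U \<and> (\<forall>y\<in>U. c < f y))"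
  (is "?L \<longleftrightarrow> ?R")
proof
  assume L: ?L
  show ?R
  proof (intro ballI allI impI)
    fix x c assume "x \<in> topspace T" "c < f x"
    with L show "\<exists>U. openin T U \<and> x \<in> U \<and> (\<forall>y\<in>U. c < f y)"
      unfolding lower_semicontinuous_map_def
      by (intro exI[of _ "{x \<in> topspace T. c < f x}"]) auto
  qed
next
  assume R: ?R
  show ?L
    unfolding lower_semicontinuous_map_def
  proof
    fix c
    have "\<exists>U. openin T U \<and> x \<in> U \<and> U \<subseteq> {x \<in> topspace T. c < f x}"
      if x: "x \<in> {x \<in> topspace T. c < f x}" for x
    proof -
      from x R obtain U where U: "openin T U" "x \<in> U" "\<forall>y\<in>U. c < f y"
        by blast
      from U(1) have "U \<subseteq> topspace T"
        by (rule openin_subset)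
      with U show ?thesis
        by blast
    qed
    then show "openin T {x \<in> topspace T. c < f x}"
      using openin_subopen[of T "{x \<in> topspace T. c < f x}"] by blast
  qed
qed

end

theory Submission
  imports Defs
begin

text \<open>
  Write \<open>f x\<close> for the distance from \<open>x\<close> to \<open>F x\<close>. The hypothesis says that from every point that
  is not fixed one can move to another point in such a way that \<open>f\<close> drops by at least the length of
  the step, as measured by \<open>\<delta>\<close>. A lower semicontinuous function that is bounded below on a complete
  metric space always has a point from which no such step is possible (the variational principle
  of Ekeland, lemma \<open>exists_point_of_slow_descent\<close>), and at such a point the hypothesis
  leaves only the alternative that the point is fixed. The lower bound here is \<open>0\<close>, since \<open>f\<close> is
  a distance.

  For the variational principle, descend greedily: the points reachable from \<open>x\<close> by an admissible
  step form a set \<open>S x\<close>, and the triangle inequality makes reachability transitive. Choosing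
  \<open>x\<^sub>n\<^sub>+\<^sub>1\<close> in \<open>S x\<^sub>n\<close> with nearly the least value of \<open>f\<close> gives decreasing values, whose convergence
  makes the \<open>x\<^sub>n\<close> Cauchy. By semicontinuity the limit \<open>v\<close> lies in every \<open>S x\<^sub>n\<close>; whatever is
  reachable from \<open>v\<close> is therefore reachable from every \<open>x\<^sub>n\<close>, so it cannot have a value of \<open>f\<close> below
  that of \<open>v\<close>, and hence it is \<open>v\<close> itself.
\<close>

lemma lower_semicontinuous_map_limit_le:
  assumes lsc: "lower_semicontinuous_map T f"
    and lim: "limitin T s v G" "((\<lambda>n. f (s n)) \<longlongrightarrow> L) G" and "G \<noteq> bot"
  shows "f v \<le> L"
proof (rule ccontr)
  assume "\<not> f v \<le> L"
  then obtain c where c: "L < c" "c < f v"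
    using dense[of L "f v"] by auto
  have "openin T {x \<in> topspace T. c < f x}"
    using lsc by (simp add: lower_semicontinuous_map_def)
  moreover have "v \<in> {x \<in> topspace T. c < f x}"
    using lim(1) c by (simp add: limitin_def)
  ultimately have "eventually (\<lambda>n. s n \<in> {x \<in> topspace T. c < f x}) G"
    using lim(1) unfolding limitin_def by blast
  moreover have "eventually (\<lambda>n. f (s n) < c) G"
    using lim(2) c(1) by (rule order_tendstoD)
  ultimately have "eventually (\<lambda>n. False) G"
    by eventually_elim auto
  with \<open>G \<noteq> bot\<close> show False
    by simp
qed

context Metric_space
begin

text \<open>
  The metric is dominated by the decrease of \<open>u\<close>, and a decreasing sequence that is
  bounded below is Cauchy.
\<close>

lemma MCauchy_if_dist_le_descent:
  assumes s: "range s \<subseteq> M"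
    and step: "\<And>m n. m \<le> n \<Longrightarrow> d (s m) (s n) \<le> u m - u n"
    and bound: "\<And>n. B \<le> u n"
  shows "MCauchy s"
  unfolding MCauchy_def
proof (intro conjI s allI impI)
  fix e :: real assume "e > 0"
  have "decseq u"
  proof (rule decseq_SucI)
    fix n
    have "0 \<le> d (s n) (s (Suc n))"
      by simp
    with step[of n "Suc n"] show "u (Suc n) \<le> u n"
      by linarith
  qed
  then obtain L where "u \<longlonglongrightarrow> L" and L: "\<And>i. L \<le> u i"
    using decseq_convergent[of u B] bound by metis
  then have "eventually (\<lambda>n. u n < L + e) sequentially"
    using \<open>e > 0\<close> by (intro order_tendstoD) auto
  then obtain N where N: "\<And>n. N \<le> n \<Longrightarrow> u n < L + e"
    by (auto simp: eventually_sequentially)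
  have close: "d (s m) (s n) < e" if "N \<le> m" "m \<le> n" for m n
    using step[OF that(2)] N[OF that(1)] L[of n] by linarith
  show "\<exists>N. \<forall>m n. N \<le> m \<longrightarrow> N \<le> n \<longrightarrow> d (s m) (s n) < e"
    by (metis close commute nle_le)
qed

text \<open>
  As \<open>n\<close> tends to infinity the right-hand side of the estimate for \<open>s m\<close> and \<open>s n\<close> tends to
  \<open>f (s m) - L\<close>, and lower semicontinuity, in the form \<open>f v \<le> L\<close>, makes this at most
  \<open>f (s m) - f v\<close>. Thus reachability by an admissible step is preserved in the limit.
\<close>

lemma dist_limit_le_descent:
  assumes lsc: "lower_semicontinuous_map mtopology f"
    and s: "range s \<subseteq> M"
    and step: "\<And>m n. m \<le> n \<Longrightarrow> d (s m) (s n) \<le> f (s m) - f (s n)"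
    and lim: "limitin mtopology s v sequentially" "(\<lambda>n. f (s n)) \<longlonglongrightarrow> L"
  shows "d (s m) v \<le> f (s m) - f v"
proof -
  have v: "v \<in> M"
    using lim(1) by (rule limitin_mspace)
  have "f v \<le> L"
    by (rule lower_semicontinuous_map_limit_le[OF lsc lim]) simp
  moreover have "d (s m) v \<le> f (s m) - L"
  proof (rule LIMSEQ_le_const)
    have "(\<lambda>n. d (s n) v) \<longlonglongrightarrow> 0"
      using lim(1) by (simp add: limitin_metric_dist_null)
    then show "(\<lambda>n. f (s m) - f (s n) + d (s n) v) \<longlonglongrightarrow> f (s m) - L"
      using tendsto_add[OF tendsto_diff[OF tendsto_const lim(2)]] by fastforce
    have "d (s m) v \<le> f (s m) - f (s n) + d (s n) v" if "m \<le> n" for n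
      using triangle[of "s m" "s n" v] step[OF that] s v by fastforce
    then show "\<exists>N. \<forall>n\<ge>N. d (s m) v \<le> f (s m) - f (s n) + d (s n) v"
      by blast
  qed
  ultimately show ?thesis
    by linarith
qed

text \<open>
  The variational principle of Ekeland: at \<open>v\<close>, moving by some distance never lowers \<open>f\<close> by as
  much as that distance.
\<close>

lemma exists_point_of_slow_descent:
  assumes complete: mcomplete and "M \<noteq> {}"
    and lsc: "lower_semicontinuous_map mtopology f"
    and bound: "\<And>x. x \<in> M \<Longrightarrow> B \<le> f x"
  shows "\<exists>v\<in>M. \<forall>z\<in>M - {v}. f v - f z < d v z"
proof -
  define S where "S x = {z \<in> M. d x z \<le> f x - f z}" for x
  have S_refl: "x \<in> S x" if "x \<in> M" for x
    using that by (simp add: S_def)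
  have S_trans: "z \<in> S x" if "x \<in> M" "y \<in> S x" "z \<in> S y" for x y z
    using that triangle[of x y z] by (auto simp: S_def)
  have bdd: "bdd_below (f ` S x)" for x
    using bound by (intro bdd_belowI2[of _ B]) (auto simp: S_def)
  \<comment> \<open>The infimum need not be attained, hence the slack \<open>(1/2) ^ n\<close>; any null sequence would do.\<close>
  have "\<exists>y. y \<in> M \<and> (y \<in> S x \<and> f y < (INF z\<in>S x. f z) + (1/2) ^ n)" if "x \<in> M" for x n
  proof -
    have "f ` S x \<noteq> {}"
      using S_refl[OF that] by blast
    then obtain y where "y \<in> S x" "f y < (INF z\<in>S x. f z) + (1/2) ^ n"
      using cInf_lessD[of "f ` S x" "(INF z\<in>S x. f z) + (1/2) ^ n"] by auto
    then show ?thesis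
      by (auto simp: S_def)
  qed
  with \<open>M \<noteq> {}\<close> obtain s where sM: "\<And>n. s n \<in> M"
    and s_step: "\<And>n. s (Suc n) \<in> S (s n)"
    and s_min: "\<And>n. f (s (Suc n)) < (INF z\<in>S (s n). f z) + (1/2) ^ n"
    using dependent_nat_choice[of "\<lambda>_ x. x \<in> M"
        "\<lambda>n x y. y \<in> S x \<and> f y < (INF z\<in>S x. f z) + (1/2) ^ n"]
    by blast
  have s_mono: "s n \<in> S (s m)" if "m \<le> n" for m n
    using that by (induction n rule: dec_induct) (use S_refl S_trans sM s_step in blast)+
  have descent: "d (s m) (s n) \<le> f (s m) - f (s n)" if "m \<le> n" for m n
    using s_mono[OF that] by (simp add: S_def)
  have "MCauchy s"
    by (rule MCauchy_if_dist_le_descent[where u = "\<lambda>n. f (s n)"])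
      (use sM descent bound in auto)
  then obtain v where v: "limitin mtopology s v sequentially"
    using complete by (auto simp: mcomplete_def)
  have vM: "v \<in> M"
    using v by (rule limitin_mspace)
  have "decseq (\<lambda>n. f (s n))"
    unfolding decseq_def using descent nonneg by (metis diff_ge_0_iff_ge order_trans)
  then obtain L where L: "(\<lambda>n. f (s n)) \<longlonglongrightarrow> L"
    using decseq_convergent[of "\<lambda>n. f (s n)" B] bound sM by metis
  have v_S: "v \<in> S (s n)" for n
    using dist_limit_le_descent[OF lsc _ descent v L] sM vM by (auto simp: S_def)
  have fv: "f v \<le> L"
    by (rule lower_semicontinuous_map_limit_le[OF lsc v L]) simp
  have "z = v" if z: "z \<in> S v" for z
  proof -
    have low: "f (s (Suc n)) \<le> f z + (1/2) ^ n" for n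
    proof -
      have "z \<in> S (s n)"
        using S_trans[OF sM v_S z] .
      then have "(INF z\<in>S (s n). f z) \<le> f z"
        using bdd by (rule cINF_lower[rotated])
      with s_min[of n] show ?thesis
        by linarith
    qed
    have "L \<le> f z + 0"
    proof (rule LIMSEQ_le)
      show "(\<lambda>n. f (s (Suc n))) \<longlonglongrightarrow> L"
        using L by (rule LIMSEQ_Suc)
      show "(\<lambda>n. f z + (1/2) ^ n) \<longlonglongrightarrow> f z + 0"
        by (intro tendsto_intros LIMSEQ_power_zero) simp
    qed (use low in blast)
    with fv z have "d v z \<le> 0" "z \<in> M"
      by (auto simp: S_def)
    with vM show ?thesis
      by (metis mdist_pos_less not_le)
  qed
  then have "\<forall>z\<in>M - {v}. f v - f z < d v z"
    by (force simp: S_def)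
  with vM show ?thesis
    by blast
qed

end

lemma point_set_dist_nonneg:
  assumes "Metric_space Y d" "A \<noteq> {}"
  shows "0 \<le> point_set_dist d x A"
  unfolding point_set_dist_def
  using assms by (intro cINF_greatest) (auto simp: Metric_space.nonneg)

theorem theorem3p3:
  fixes X Y :: "'a set"
    and d \<delta> :: "'a \<Rightarrow> 'a \<Rightarrow> real"
    and F :: "'a \<Rightarrow> 'a set"
  assumes "Metric_space Y d"
    and "X \<subseteq> Y"
    and "Metric_space X \<delta>"
    and "Metric_space.mcomplete X \<delta>"
    and "X \<noteq> {}"
    and "\<And>x. x \<in> X \<Longrightarrow> F x \<subseteq> Y \<and> F x \<noteq> {}"
    and "lower_semicontinuous_map (Metric_space.mtopology X \<delta>) (\<lambda>x. point_set_dist d x (F x))"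
    and "\<And>x. x \<in> X \<Longrightarrow> x \<notin> F x \<Longrightarrow>
           \<exists>z \<in> X - {x}. \<delta> x z \<le> point_set_dist d x (F x) - point_set_dist d z (F z)"
  shows "\<exists>x \<in> X. x \<in> F x"
proof -
  interpret X: Metric_space X \<delta>
    by fact
  have "0 \<le> point_set_dist d x (F x)" if "x \<in> X" for x
    using assms(1) assms(6)[OF that] by (intro point_set_dist_nonneg) auto
  then obtain v where "v \<in> X"
    and "\<forall>z\<in>X - {v}. point_set_dist d v (F v) - point_set_dist d z (F z) < \<delta> v z"
    using X.exists_point_of_slow_descent[OF assms(4,5,7)] by blast
  with assms(8)[of v] show ?thesis
    by (meson not_le)
qed

end
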